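(* Let $B_3=\langle s_1,s_2\mid s_1s_2s_1=s_2s_1s_2\rangle$ be the braid group on $3$ strands. For $\lambda_1,\lambda_2,\lambda_3\in\mathbb C^\times$ put $$A=\begin{pmatrix}\lambda_3&0&0\\\lambda_1\lambda_3+\lambda_2^2&\lambda_2&0\\\lambda_2&1&\lambda_1\end{pmatrix},\qquad B=\begin{pmatrix}\lambda_1&-1&\lambda_2\\0&\lambda_2&-\lambda_1\lambda_3-\lambda_2^2\\0&0&\lambda_3\end{pmatrix}.$$ (a) Let $\varrho:B_3\to GL_3(\mathbb C)$ be an irreducible representation and let $\lambda_1,\lambda_2,\lambda_3$ be the eigenvalues (with multiplicity) of $\varrho(s_1)$. Then $$\frac{(\lambda_1^2+\lambda_2\lambda_3)(\lambda_2^2+\lambda_1\lambda_3)(\lambda_3^2+\lambda_1\lambda_2)}{(\lambda_1\lambda_2\lambda_3)^2}\neq0,$$ and $\varrho$ is equivalent to the representation $s_1\mapsto A$, $s_2\mapsto B$. (b) Conversely, if $\lambda_1,\lambda_2,\lambda_3\in\mathbb C^\times$ satisfy this inequality, then $s_1\mapsto A$, $s_2\mapsto B$ defines an irreducible representation of $B_3$. *)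

theory Defs
  imports "HOL-Analysis.Analysis" "HOL-Algebra.Group"
    "HOL-Computational_Algebra.Polynomial"
begin

section \<open>Groups given by generators and relations\<close>

text \<open>
  A letter \<open>(a, True)\<close> stands for the generator \<open>a\<close> and \<open>(a, False)\<close> for its formal inverse.
  For a set \<open>R\<close> of relations \<open>u = v\<close> (pairs of words), two words are identified by the smallest
  congruence on the free monoid containing \<open>R\<close> and all cancellations; its quotient is the group
  presented by \<open>R\<close>.
\<close>

type_synonym 'a gword = "('a \<times> bool) list"

inductive pres_eq :: "('a gword \<times> 'a gword) set \<Rightarrow> 'a gword \<Rightarrow> 'a gword \<Rightarrow> bool"
  for R where
  refl: "pres_eq R u u"
| sym: "pres_eq R u v \<Longrightarrow> pres_eq R v u"
| trans: "pres_eq R u v \<Longrightarrow> pres_eq R v w \<Longrightarrow> pres_eq R u w"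
| append: "pres_eq R u u' \<Longrightarrow> pres_eq R v v' \<Longrightarrow> pres_eq R (u @ v) (u' @ v')"
| cancel: "pres_eq R [(a, b), (a, \<not> b)] []"
| rel: "(u, v) \<in> R \<Longrightarrow> pres_eq R u v"

definition pres_class :: "('a gword \<times> 'a gword) set \<Rightarrow> 'a gword \<Rightarrow> 'a gword set" where
  "pres_class R w = {v. pres_eq R w v}"

definition presented_group :: "('a gword \<times> 'a gword) set \<Rightarrow> 'a gword set monoid" where
  "presented_group R =
     \<lparr>carrier = range (pres_class R),
      mult = (\<lambda>X Y. \<Union>u\<in>X. \<Union>v\<in>Y. pres_class R (u @ v)),
      one = pres_class R []\<rparr>"

definition pres_gen :: "('a gword \<times> 'a gword) set \<Rightarrow> 'a \<Rightarrow> 'a gword set" where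
  "pres_gen R a = pres_class R [(a, True)]"

lemma pres_class_eq_iff: "pres_class R u = pres_class R v \<longleftrightarrow> pres_eq R u v"
  unfolding pres_class_def by (blast intro: pres_eq.refl pres_eq.sym pres_eq.trans)

lemma mult_pres_class:
  "pres_class R u \<otimes>\<^bsub>presented_group R\<^esub> pres_class R v = pres_class R (u @ v)"
proof -
  have eq: "pres_class R (u' @ v') = pres_class R (u @ v)"
    if "u' \<in> pres_class R u" "v' \<in> pres_class R v" for u' v'
  proof -
    have "pres_eq R u u'" "pres_eq R v v'"
      using that by (simp_all add: pres_class_def)
    then have "pres_eq R (u @ v) (u' @ v')"
      by (rule pres_eq.append)
    then show ?thesis
      by (simp add: pres_class_eq_iff pres_eq.sym)
  qed
  have "u \<in> pres_class R u" "v \<in> pres_class R v"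
    by (simp_all add: pres_class_def pres_eq.refl)
  then have "(\<Union>u'\<in>pres_class R u. \<Union>v'\<in>pres_class R v. pres_class R (u' @ v')) =
      pres_class R (u @ v)"
    using eq by blast
  then show ?thesis
    by (simp add: presented_group_def)
qed

lemma pres_eq_inverse:
  "pres_eq R (rev (map (\<lambda>(a, b). (a, \<not> b)) w) @ w) []"
proof (induction w)
  case Nil
  then show ?case by (simp add: pres_eq.refl)
next
  case (Cons x w)
  obtain a b where x: "x = (a, b)" by (cases x)
  let ?i = "rev (map (\<lambda>(a, b). (a, \<not> b)) w)"
  have "pres_eq R [(a, \<not> b), (a, b)] []"
    using pres_eq.cancel[of R a "\<not> b"] by simp
  then have "pres_eq R (?i @ ([(a, \<not> b), (a, b)] @ w)) (?i @ ([] @ w))"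
    by (intro pres_eq.append pres_eq.refl)
  then have "pres_eq R (rev (map (\<lambda>(a, b). (a, \<not> b)) (x # w)) @ x # w) (?i @ w)"
    by (simp add: x)
  then show ?case
    using Cons.IH by (rule pres_eq.trans)
qed

lemma group_presented_group: "group (presented_group R)"
proof -
  let ?G = "presented_group R"
  have car: "X \<in> carrier ?G \<longleftrightarrow> (\<exists>w. X = pres_class R w)" for X
    by (auto simp: presented_group_def)
  have one: "\<one>\<^bsub>?G\<^esub> = pres_class R []"
    by (simp add: presented_group_def)
  have inv: "\<exists>Y\<in>carrier ?G. Y \<otimes>\<^bsub>?G\<^esub> X = \<one>\<^bsub>?G\<^esub>" if X: "X \<in> carrier ?G" for X
  proof -
    from X obtain w where w: "X = pres_class R w"
      by (auto simp: car)
    let ?i = "rev (map (\<lambda>(a, b). (a, \<not> b)) w)"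
    have "pres_class R ?i \<otimes>\<^bsub>?G\<^esub> X = \<one>\<^bsub>?G\<^esub>"
      unfolding w one mult_pres_class pres_class_eq_iff by (rule pres_eq_inverse)
    then show ?thesis
      using car by blast
  qed
  show ?thesis
    by (rule groupI) (use inv in \<open>auto simp: car one mult_pres_class\<close>)
qed

section \<open>Matrix representations\<close>

definition GL :: "('k::field ^ 'n ^ 'n) monoid" where
  "GL = \<lparr>carrier = {M. invertible M}, mult = (**), one = mat 1\<rparr>"

definition representation :: "('g, 'b) monoid_scheme \<Rightarrow> ('g \<Rightarrow> 'k::field ^ 'n ^ 'n) \<Rightarrow> bool" where
  "representation G \<rho> \<longleftrightarrow> \<rho> \<in> hom G GL"

text \<open>\<^term>\<open>vec.subspace\<close> is the notion of subspace over the field \<open>'k\<close> of the entries (whereas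
  \<^term>\<open>subspace\<close> refers to the real scalars).\<close>

definition irreducible_rep :: "('g, 'b) monoid_scheme \<Rightarrow> ('g \<Rightarrow> 'k::field ^ 'n ^ 'n) \<Rightarrow> bool" where
  "irreducible_rep G \<rho> \<longleftrightarrow> representation G \<rho> \<and>
     (\<forall>W. vec.subspace W \<and> (\<forall>g\<in>carrier G. \<forall>w\<in>W. \<rho> g *v w \<in> W) \<longrightarrow> W = {0} \<or> W = UNIV)"

definition equivalent_rep ::
  "('g, 'b) monoid_scheme \<Rightarrow> ('g \<Rightarrow> 'k::field ^ 'n ^ 'n) \<Rightarrow> ('g \<Rightarrow> 'k ^ 'n ^ 'n) \<Rightarrow> bool" where
  "equivalent_rep G \<rho> \<sigma> \<longleftrightarrow> (\<exists>P. invertible P \<and> (\<forall>g\<in>carrier G. P ** \<rho> g = \<sigma> g ** P))"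

definition charpoly :: "'k::field ^ 'n ^ 'n \<Rightarrow> 'k poly" where
  "charpoly M = det (mat [:0, 1:] - (\<chi> i j. [:M $ i $ j:]))"

definition eigenvalues :: "'k::field ^ 'n ^ 'n \<Rightarrow> 'k multiset" where
  "eigenvalues M = proots (charpoly M)"

section \<open>The braid group on three strands\<close>

datatype braid_gen = S1 | S2

definition braid_rels :: "(braid_gen gword \<times> braid_gen gword) set" where
  "braid_rels = {([(S1, True), (S2, True), (S1, True)], [(S2, True), (S1, True), (S2, True)])}"

definition B3 :: "braid_gen gword set monoid" where
  "B3 = presented_group braid_rels"

definition s1 :: "braid_gen gword set" where "s1 = pres_gen braid_rels S1"

definition s2 :: "braid_gen gword set" where "s2 = pres_gen braid_rels S2"

definition rep_with_images ::
  "(braid_gen gword set \<Rightarrow> 'k::field ^ 'n ^ 'n) \<Rightarrow> 'k ^ 'n ^ 'n \<Rightarrow> 'k ^ 'n ^ 'n \<Rightarrow> bool" where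
  "rep_with_images \<sigma> M N \<longleftrightarrow> representation B3 \<sigma> \<and> \<sigma> s1 = M \<and> \<sigma> s2 = N"

lemma group_GL: "group (GL :: ('k::field ^ 'n ^ 'n) monoid)"
proof (rule groupI)
  fix M :: "'k ^ 'n ^ 'n" assume "M \<in> carrier GL"
  then obtain N where "M ** N = mat 1" "N ** M = mat 1"
    by (auto simp: GL_def invertible_def)
  moreover from this have "invertible N"
    unfolding invertible_def by blast
  ultimately show "\<exists>N\<in>carrier GL. N \<otimes>\<^bsub>GL\<^esub> M = \<one>\<^bsub>GL\<^esub>"
    by (auto simp: GL_def)
next
  show "\<one>\<^bsub>GL\<^esub> \<in> carrier (GL :: ('k ^ 'n ^ 'n) monoid)"
    unfolding GL_def invertible_def by (auto intro: exI[of _ "mat 1"])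
qed (simp_all add: GL_def invertible_mult matrix_mul_assoc)

text \<open>There is at most one representation with given images of the generators.\<close>

lemma rep_with_images_unique:
  assumes "rep_with_images \<sigma> M N" "rep_with_images \<tau> M N" "g \<in> carrier B3"
  shows "\<sigma> g = \<tau> g"
proof -
  have G: "group B3" by (simp add: B3_def group_presented_group)
  have hom: "group_hom B3 GL \<sigma>" "group_hom B3 GL \<tau>"
    using assms G group_GL
    by (auto simp: rep_with_images_def representation_def group_hom_def group_hom_axioms_def)
  let ?c = "pres_class braid_rels"
  have car: "?c w \<in> carrier B3" for w by (simp add: B3_def presented_group_def)
  have one: "?c [] = \<one>\<^bsub>B3\<^esub>" by (simp add: B3_def presented_group_def)
  have mul: "?c (u @ v) = ?c u \<otimes>\<^bsub>B3\<^esub> ?c v" for u v by (simp add: B3_def mult_pres_class)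
  have gen: "\<sigma> (?c [(a, True)]) = \<tau> (?c [(a, True)])" for a
    using assms(1,2) by (cases a) (simp_all add: rep_with_images_def s1_def s2_def pres_gen_def)
  have inv: "?c [(a, False)] = inv\<^bsub>B3\<^esub> ?c [(a, True)]" for a
  proof (rule group.inv_equality[OF G, symmetric])
    show "?c [(a, False)] \<otimes>\<^bsub>B3\<^esub> ?c [(a, True)] = \<one>\<^bsub>B3\<^esub>"
      using pres_eq.cancel[of braid_rels a False] by (simp add: pres_class_eq_iff flip: mul one)
  qed (rule car)+
  have letter: "\<sigma> (?c [x]) = \<tau> (?c [x])" for x
  proof (cases x)
    case (Pair a b)
    show ?thesis
      using gen[of a] hom[THEN group_hom.hom_inv, OF car[of "[(a, True)]"]]
      by (cases b) (simp_all add: Pair inv)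
  qed
  have "\<sigma> (?c w) = \<tau> (?c w)" for w
  proof (induction w)
    case Nil
    then show ?case using hom[THEN group_hom.hom_one] by (simp add: one)
  next
    case (Cons x w)
    then show ?case
      using hom[THEN group_hom.hom_mult, OF car[of "[x]"] car[of w]] letter[of x]
      by (simp flip: mul)
  qed
  then show ?thesis using assms(3) by (auto simp: B3_def presented_group_def)
qed

section \<open>The matrices\<close>

definition matA :: "complex \<Rightarrow> complex \<Rightarrow> complex \<Rightarrow> complex ^ 3 ^ 3" where
  "matA l1 l2 l3 = vector
     [vector [l3,              0,  0],
      vector [l1 * l3 + l2\<^sup>2,  l2, 0],
      vector [l2,              1,  l1]]"

definition matB :: "complex \<Rightarrow> complex \<Rightarrow> complex \<Rightarrow> complex ^ 3 ^ 3" where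
  "matB l1 l2 l3 = vector
     [vector [l1, -1, l2],
      vector [0,  l2, - l1 * l3 - l2\<^sup>2],
      vector [0,  0,  l3]]"

end

theory Submission
  imports Defs "HOL-Computational_Algebra.Fundamental_Theorem_Algebra"
begin

text \<open>
  Let \<open>X\<close>, \<open>Y\<close> be the images of the generators in an irreducible representation, \<open>T = X Y X\<close> and
  \<open>S = X Y\<close>. Then \<open>T\<^sup>2 = S\<^sup>3\<close> is central, hence a scalar, and since \<open>T\<close> is not a scalar itself it is
  a multiple of an involution \<open>2 p q\<^sup>T - 1\<close> with \<open>q\<^sup>T p = 1\<close>. The vectors \<open>p\<close>, \<open>S p\<close>, \<open>S\<^sup>2 p\<close> span an
  invariant subspace, so they form a basis, in which \<open>S\<close> is the companion matrix of
  \<open>x\<^sup>3 - (det X)\<^sup>2\<close> and \<open>T\<close> depends only on \<open>det X\<close>, \<open>q\<^sup>T S p\<close> and \<open>q\<^sup>T S\<^sup>2 p\<close>. The traces of \<open>T S\<close> and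
  \<open>T S\<^sup>2\<close> express these numbers through the characteristic polynomial of \<open>X\<close>. The pair \<open>A\<close>, \<open>B\<close> has
  the same data, so there is a nonzero intertwiner, which is injective by irreducibility. If
  \<open>l2\<^sup>2 + l1 l3 = 0\<close>, the plane spanned by \<open>e1\<close> and \<open>e3\<close> is invariant under \<open>A\<close> and \<open>B\<close>.
\<close>

section \<open>Homomorphisms out of presented groups\<close>

lemma pres_gen_carrier [simp]: "pres_gen R a \<in> carrier (presented_group R)"
  by (auto simp: pres_gen_def presented_group_def)

lemma inv_pres_gen: "inv\<^bsub>presented_group R\<^esub> pres_gen R a = pres_class R [(a, False)]"
proof (rule group.inv_equality[OF group_presented_group])
  show "pres_class R [(a, False)] \<otimes>\<^bsub>presented_group R\<^esub> pres_gen R a = \<one>\<^bsub>presented_group R\<^esub>"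
    using pres_eq.cancel[of R a False]
    by (simp add: pres_gen_def mult_pres_class) (simp add: presented_group_def pres_class_eq_iff)
qed (auto simp: pres_gen_def presented_group_def)

text \<open>A word is a product of letters, and the class of a negative letter is the inverse of a
  generator, so induction on words suffices.\<close>

lemma presented_group_induct [consumes 1, case_names one gen mult inv]:
  assumes "g \<in> carrier (presented_group R)"
    and one: "P \<one>\<^bsub>presented_group R\<^esub>"
    and gen: "\<And>a. P (pres_gen R a)"
    and mult: "\<And>x y. \<lbrakk>x \<in> carrier (presented_group R); y \<in> carrier (presented_group R); P x; P y\<rbrakk>
      \<Longrightarrow> P (x \<otimes>\<^bsub>presented_group R\<^esub> y)"
    and inv: "\<And>x. \<lbrakk>x \<in> carrier (presented_group R); P x\<rbrakk> \<Longrightarrow> P (inv\<^bsub>presented_group R\<^esub> x)"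
  shows "P g"
proof -
  have car: "pres_class R w \<in> carrier (presented_group R)" for w
    by (simp add: presented_group_def)
  have "P (pres_class R w)" for w
  proof (induction w)
    case Nil
    then show ?case using one by (simp add: presented_group_def)
  next
    case (Cons x w)
    obtain a b where x: "x = (a, b)" by (cases x)
    have "P (pres_class R [x])"
      using gen[of a] inv[OF _ gen[of a]] by (cases b) (simp_all add: x inv_pres_gen flip: pres_gen_def)
    then show ?case
      using mult[OF car car _ Cons.IH, of "[x]"] by (simp add: mult_pres_class)
  qed
  then show ?thesis using assms(1) by (auto simp: presented_group_def)
qed

section \<open>The universal property of a presented group\<close>

definition word_eval :: "('b, 'c) monoid_scheme \<Rightarrow> ('a \<Rightarrow> 'b) \<Rightarrow> 'a gword \<Rightarrow> 'b" where
  "word_eval H f w =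
     foldr (\<lambda>(a, b) y. (if b then f a else inv\<^bsub>H\<^esub> f a) \<otimes>\<^bsub>H\<^esub> y) w \<one>\<^bsub>H\<^esub>"

context group
begin

lemma word_eval_closed:
  assumes "\<And>a. f a \<in> carrier G"
  shows "word_eval G f w \<in> carrier G"
  using assms by (induction w) (auto simp: word_eval_def)

lemma word_eval_append:
  assumes "\<And>a. f a \<in> carrier G"
  shows "word_eval G f (u @ v) = word_eval G f u \<otimes> word_eval G f v"
proof (induction u)
  case Nil
  have "word_eval G f v = \<one> \<otimes> word_eval G f v"
    using word_eval_closed[of f v, OF assms] by simp
  then show ?case by (simp add: word_eval_def)
next
  case (Cons x u)
  obtain a b where x: "x = (a, b)" by (cases x)
  have step: "word_eval G f (x # w) = (if b then f a else inv f a) \<otimes> word_eval G f w" for w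
    by (simp add: word_eval_def x)
  show ?case
    using word_eval_closed[of f, OF assms] assms[of a]
    by (simp only: append_Cons step Cons.IH) (simp add: m_assoc)
qed

lemma word_eval_pres_eq:
  assumes f: "\<And>a. f a \<in> carrier G"
    and R: "\<And>u v. (u, v) \<in> R \<Longrightarrow> word_eval G f u = word_eval G f v"
    and "pres_eq R u v"
  shows "word_eval G f u = word_eval G f v"
  using assms(3)
proof induction
  case (cancel a b)
  then show ?case using f[of a] by (auto simp: word_eval_def)
qed (simp_all add: R word_eval_append[OF f])

text \<open>Evaluation of words is multiplicative and, by \<open>word_eval_pres_eq\<close>, constant
  on classes as soon as it respects the relations.\<close>

lemma presented_group_hom_exists:
  assumes f: "\<And>a. f a \<in> carrier G"
    and R: "\<And>u v. (u, v) \<in> R \<Longrightarrow> word_eval G f u = word_eval G f v"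
  obtains h where "h \<in> hom (presented_group R) G" "\<And>a. h (pres_gen R a) = f a"
proof
  \<comment> \<open>The class is evaluated at an arbitrary representative; \<open>h\<close> below
    shows that the choice does not matter.\<close>
  define h where "h = (\<lambda>C. word_eval G f (SOME w. w \<in> C))"
  have h: "h (pres_class R w) = word_eval G f w" for w
  proof -
    have "w \<in> pres_class R w" by (simp add: pres_class_def pres_eq.refl)
    then have "(SOME w'. w' \<in> pres_class R w) \<in> pres_class R w" by (rule someI)
    then show ?thesis
      unfolding h_def using word_eval_pres_eq[OF f R] by (simp add: pres_class_def)
  qed
  show "h (pres_gen R a) = f a" for a
    using f[of a] by (simp add: pres_gen_def h) (simp add: word_eval_def)
  show "h \<in> hom (presented_group R) G"
  proof (rule homI)
    fix x y assume "x \<in> carrier (presented_group R)" "y \<in> carrier (presented_group R)"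
    then obtain u v where "x = pres_class R u" "y = pres_class R v"
      by (auto simp: presented_group_def)
    then show "h (x \<otimes>\<^bsub>presented_group R\<^esub> y) = h x \<otimes> h y"
      by (simp add: mult_pres_class h word_eval_append[OF f])
  qed (use h word_eval_closed[of f, OF f] in \<open>auto simp: presented_group_def\<close>)
qed

end

section \<open>Representations of the braid group\<close>

lemma B3_induct [consumes 1, case_names one s1 s2 mult inv]:
  assumes "g \<in> carrier B3" "P \<one>\<^bsub>B3\<^esub>" "P s1" "P s2"
    and "\<And>x y. \<lbrakk>x \<in> carrier B3; y \<in> carrier B3; P x; P y\<rbrakk> \<Longrightarrow> P (x \<otimes>\<^bsub>B3\<^esub> y)"
    and "\<And>x. \<lbrakk>x \<in> carrier B3; P x\<rbrakk> \<Longrightarrow> P (inv\<^bsub>B3\<^esub> x)"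
  shows "P g"
  using assms(1) unfolding B3_def
proof (induction rule: presented_group_induct)
  case (gen a)
  then show ?case using assms(3,4) by (cases a) (simp_all add: s1_def s2_def)
qed (use assms(2,5,6) in \<open>simp_all add: B3_def\<close>)

lemma s1_carrier [simp]: "s1 \<in> carrier B3" and s2_carrier [simp]: "s2 \<in> carrier B3"
  by (simp_all add: s1_def s2_def B3_def)

lemma group_B3: "group B3"
  by (simp add: B3_def group_presented_group)

lemma braid_relation: "s1 \<otimes>\<^bsub>B3\<^esub> s2 \<otimes>\<^bsub>B3\<^esub> s1 = s2 \<otimes>\<^bsub>B3\<^esub> s1 \<otimes>\<^bsub>B3\<^esub> s2"
  unfolding B3_def s1_def s2_def pres_gen_def mult_pres_class pres_class_eq_iff
  by (rule pres_eq.rel) (simp add: braid_rels_def)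

lemma rep_with_images_exists:
  fixes M N :: "'k::field ^ 'n ^ 'n"
  assumes "invertible M" "invertible N" "M ** N ** M = N ** M ** N"
  obtains \<sigma> where "rep_with_images \<sigma> M N"
proof -
  let ?f = "case_braid_gen M N"
  have car: "?f a \<in> carrier GL" for a
    using assms(1,2) by (cases a) (simp_all add: GL_def)
  have "word_eval GL ?f u = word_eval GL ?f v" if "(u, v) \<in> braid_rels" for u v
  proof -
    have uv: "u = [(S1, True), (S2, True), (S1, True)]" "v = [(S2, True), (S1, True), (S2, True)]"
      using that by (simp_all add: braid_rels_def)
    have "word_eval GL ?f u = M ** N ** M" "word_eval GL ?f v = N ** M ** N"
      unfolding uv by (simp_all add: word_eval_def GL_def matrix_mul_assoc)
    with assms(3) show ?thesis by (simp only:)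
  qed
  then obtain h where "h \<in> hom (presented_group braid_rels) GL"
    "\<And>a. h (pres_gen braid_rels a) = ?f a"
    using group.presented_group_hom_exists[OF group_GL, of ?f braid_rels] car by metis
  then show ?thesis
    by (intro that[of h]) (simp add: rep_with_images_def representation_def s1_def s2_def B3_def)
qed

context
  fixes \<rho> :: "braid_gen gword set \<Rightarrow> 'k::field ^ 'n ^ 'n"
  assumes rep: "representation B3 \<rho>"
begin

lemma rep_group_hom: "group_hom B3 GL \<rho>"
  using rep group_B3 group_GL
  by (simp add: representation_def group_hom_def group_hom_axioms_def)

lemma rep_mult:
  assumes "x \<in> carrier B3" "y \<in> carrier B3"
  shows "\<rho> (x \<otimes>\<^bsub>B3\<^esub> y) = \<rho> x ** \<rho> y"
  using group_hom.hom_mult[OF rep_group_hom assms] by (simp add: GL_def)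

lemma rep_one: "\<rho> \<one>\<^bsub>B3\<^esub> = mat 1"
  using group_hom.hom_one[OF rep_group_hom] by (simp add: GL_def)

lemma rep_invertible:
  assumes "x \<in> carrier B3"
  shows "invertible (\<rho> x)"
  using group_hom.hom_closed[OF rep_group_hom assms] by (simp add: GL_def)

lemma rep_inv:
  assumes "x \<in> carrier B3"
  shows "\<rho> (inv\<^bsub>B3\<^esub> x) ** \<rho> x = mat 1" "\<rho> x ** \<rho> (inv\<^bsub>B3\<^esub> x) = mat 1"
  using assms by (simp_all add: rep_one group.inv_closed[OF group_B3] group.l_inv[OF group_B3]
      group.r_inv[OF group_B3] flip: rep_mult)

lemma rep_braid_relation: "\<rho> s1 ** \<rho> s2 ** \<rho> s1 = \<rho> s2 ** \<rho> s1 ** \<rho> s2"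
proof -
  have "s1 \<otimes>\<^bsub>B3\<^esub> s2 \<in> carrier B3" "s2 \<otimes>\<^bsub>B3\<^esub> s1 \<in> carrier B3"
    by (simp_all add: group.is_monoid[OF group_B3] monoid.m_closed)
  then show ?thesis
    using arg_cong[OF braid_relation, of \<rho>] by (simp only: rep_mult s1_carrier s2_carrier)
qed

end

text \<open>An injective linear map of a finite-dimensional space into itself is onto. Hence a
  subspace invariant under \<open>M\<close> is also invariant under the inverse of
  \<open>M\<close>.\<close>

lemma invertible_image_eq_subspace:
  fixes M :: "'k::field ^ 'n ^ 'n"
  assumes "invertible M" "vec.subspace W" "\<forall>w\<in>W. M *v w \<in> W"
  shows "(*v) M ` W = W"
proof (rule vec.subspace_dim_equal)
  have "inj ((*v) M)"
    using assms(1) by (rule inj_matrix_vector_mult)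
  then have "vec.dim ((*v) M ` W) = vec.dim W"
    by (intro vec.dim_image_eq) (auto intro: inj_on_subset)
  then show "vec.dim W \<le> vec.dim ((*v) M ` W)" by simp
qed (use assms in \<open>auto intro: vec.subspace_image\<close>)

section \<open>Irreducibility and equivalence in terms of the generators\<close>

definition invariant_under :: "'k::field ^ 'n ^ 'n \<Rightarrow> ('k ^ 'n) set \<Rightarrow> bool" where
  "invariant_under M W \<longleftrightarrow> (\<forall>w\<in>W. M *v w \<in> W)"

definition irreducible_pair :: "'k::field ^ 'n ^ 'n \<Rightarrow> 'k ^ 'n ^ 'n \<Rightarrow> bool" where
  "irreducible_pair X Y \<longleftrightarrow> (\<forall>W. vec.subspace W \<and> invariant_under X W \<and> invariant_under Y W \<longrightarrow>
     W = {0} \<or> W = UNIV)"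

lemma irreducible_pairD:
  assumes "irreducible_pair X Y" "vec.subspace W" "invariant_under X W" "invariant_under Y W" "W \<noteq> {0}"
  shows "W = UNIV"
  using assms by (auto simp: irreducible_pair_def)

text \<open>Invariance passes to products at once and to inverses by
  \<open>invertible_image_eq_subspace\<close>, so the group and the two generators have the same
  invariant subspaces.\<close>

lemma irreducible_rep_iff_pair:
  assumes "representation B3 \<rho>"
  shows "irreducible_rep B3 \<rho> \<longleftrightarrow> irreducible_pair (\<rho> s1) (\<rho> s2)"
proof -
  have "(\<forall>g\<in>carrier B3. invariant_under (\<rho> g) W) \<longleftrightarrow>
      invariant_under (\<rho> s1) W \<and> invariant_under (\<rho> s2) W" if W: "vec.subspace W" for W
  proof (intro iffI ballI)
    fix g assume inv: "invariant_under (\<rho> s1) W \<and> invariant_under (\<rho> s2) W" and "g \<in> carrier B3"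
    from this(2) show "invariant_under (\<rho> g) W"
    proof (induction rule: B3_induct)
      case (inv x)
      have "(*v) (\<rho> x) ` W = W"
        using inv rep_invertible[OF assms] W
        by (intro invertible_image_eq_subspace) (auto simp: invariant_under_def)
      moreover have "\<rho> (inv\<^bsub>B3\<^esub> x) *v (\<rho> x *v w) = w" for w
        using rep_inv(1)[OF assms inv(1)] by (simp add: matrix_vector_mul_assoc)
      moreover have "w \<in> (*v) (\<rho> x) ` W" if "w \<in> W" for w
        using that calculation(1) by simp
      ultimately show ?case
        unfolding invariant_under_def by fastforce
    qed (use inv in \<open>simp_all add: invariant_under_def rep_one[OF assms] rep_mult[OF assms]
        flip: matrix_vector_mul_assoc\<close>)
  qed auto
  then show ?thesis
    using assms unfolding irreducible_rep_def irreducible_pair_def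
    by (fold invariant_under_def) blast
qed

lemma equivalent_rep_generatorsI:
  fixes \<rho> \<sigma> :: "braid_gen gword set \<Rightarrow> 'k::field ^ 'n ^ 'n"
  assumes rep: "representation B3 \<rho>" "representation B3 \<sigma>"
    and P: "invertible P" "P ** \<rho> s1 = \<sigma> s1 ** P" "P ** \<rho> s2 = \<sigma> s2 ** P"
  shows "equivalent_rep B3 \<rho> \<sigma>"
proof -
  have "P ** \<rho> g = \<sigma> g ** P" if "g \<in> carrier B3" for g
    using that
  proof (induction rule: B3_induct)
    case (mult x y)
    have "P ** (\<rho> x ** \<rho> y) = (P ** \<rho> x) ** \<rho> y"
      by (rule matrix_mul_assoc)
    also have "\<dots> = \<sigma> x ** (P ** \<rho> y)"
      unfolding mult(3) by (rule matrix_mul_assoc[symmetric])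
    also have "\<dots> = \<sigma> x ** \<sigma> y ** P"
      unfolding mult(4) by (rule matrix_mul_assoc)
    finally show ?case
      using mult(1,2) by (simp add: rep[THEN rep_mult])
  next
    case (inv x)
    have "P ** \<rho> (inv\<^bsub>B3\<^esub> x) = \<sigma> (inv\<^bsub>B3\<^esub> x) ** (\<sigma> x ** P) ** \<rho> (inv\<^bsub>B3\<^esub> x)"
      using rep_inv(1)[OF rep(2) inv(1)] by (simp add: matrix_mul_assoc)
    also have "\<dots> = \<sigma> (inv\<^bsub>B3\<^esub> x) ** (P ** \<rho> x) ** \<rho> (inv\<^bsub>B3\<^esub> x)"
      using inv by simp
    also have "\<dots> = \<sigma> (inv\<^bsub>B3\<^esub> x) ** P"
      using rep_inv(2)[OF rep(1) inv(1)] by (simp flip: matrix_mul_assoc)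
    finally show ?case .
  qed (simp_all add: rep[THEN rep_one] P)
  then show ?thesis using P(1) by (auto simp: equivalent_rep_def)
qed

section \<open>Matrices of size three\<close>

text \<open>Its trace is the linear coefficient of the characteristic polynomial, that is, the
  second elementary symmetric function of the eigenvalues.\<close>

definition adjugate3 :: "'k::comm_ring_1 ^ 3 ^ 3 \<Rightarrow> 'k ^ 3 ^ 3" where
  "adjugate3 M = vector
     [vector [M$2$2 * M$3$3 - M$2$3 * M$3$2, M$1$3 * M$3$2 - M$1$2 * M$3$3, M$1$2 * M$2$3 - M$1$3 * M$2$2],
      vector [M$2$3 * M$3$1 - M$2$1 * M$3$3, M$1$1 * M$3$3 - M$1$3 * M$3$1, M$1$3 * M$2$1 - M$1$1 * M$2$3],
      vector [M$2$1 * M$3$2 - M$2$2 * M$3$1, M$1$2 * M$3$1 - M$1$1 * M$3$2, M$1$1 * M$2$2 - M$1$2 * M$2$1]]"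

lemmas matrix3_simps = vec_eq_iff forall_3 sum_3 matrix_matrix_mult_def matrix_vector_mult_def

lemma mult_adjugate3: "M ** adjugate3 M = mat (det M)"
  by (simp add: adjugate3_def matrix3_simps mat_def det_3 algebra_simps)

lemma mat_mult_vector [simp]: "mat c *v x = c *s (x :: 'k::comm_ring_1 ^ 'n)"
  by (simp add: vec_eq_iff matrix_vector_mult_def mat_def if_distrib if_distribR sum.delta' cong: if_cong)

lemma mat_mult_matrix: "mat c ** M = (\<chi> i j. c * (M :: 'k::comm_ring_1 ^ 'n ^ 'm) $ i $ j)"
  by (simp add: vec_eq_iff matrix_matrix_mult_def mat_def if_distrib if_distribR sum.delta' cong: if_cong)

lemma matrix_mult_mat: "M ** mat c = mat c ** (M :: 'k::comm_ring_1 ^ 'n ^ 'm)"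
  by (simp add: mat_mult_matrix)
     (simp add: vec_eq_iff matrix_matrix_mult_def mat_def if_distrib if_distribR sum.delta mult.commute cong: if_cong)

lemma trace_mat_mult: "trace (mat c ** M) = c * trace (M :: 'k::comm_ring_1 ^ 'n ^ 'n)"
  by (simp add: mat_mult_matrix trace_def sum_distrib_left)

lemma charpoly3:
  "charpoly (M :: 'k::field ^ 3 ^ 3) = [:- det M, trace (adjugate3 M), - trace M, 1:]"
  by (simp add: charpoly_def det_3 mat_def adjugate3_def trace_def sum_3 algebra_simps)

lemma poly_charpoly3: "poly (charpoly (M :: 'k::field ^ 3 ^ 3)) x = det (mat x - M)"
  unfolding charpoly3
  by (simp add: det_3 mat_def adjugate3_def trace_def sum_3 algebra_simps)

section \<open>Eigenvectors and eigenvalues over the complex numbers\<close>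

lemma eigenvector_exists:
  fixes M :: "complex ^ 3 ^ 3"
  obtains x v where "v \<noteq> 0" "M *v v = x *s v"
proof -
  have "\<not> constant (poly (charpoly M))"
    by (simp add: constant_degree charpoly3)
  then obtain x where "poly (charpoly M) x = 0"
    using fundamental_theorem_of_algebra by blast
  then have "\<not> invertible (mat x - M)"
    by (simp add: poly_charpoly3 invertible_det_nz)
  then obtain v where "(mat x - M) *v v = 0" "v \<noteq> 0"
    unfolding invertible_left_inverse matrix_left_invertible_ker by blast
  then show ?thesis
    by (intro that[of v x]) (simp_all add: matrix_vector_mult_diff_rdistrib)
qed

text \<open>Vieta's formulas: the characteristic polynomial is monic and splits over the complex
  numbers, so its coefficients can be compared.\<close>

lemma eigenvalues3:
  fixes M :: "complex ^ 3 ^ 3"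
  assumes "eigenvalues M = {#l1, l2, l3#}"
  shows "trace M = l1 + l2 + l3" "trace (adjugate3 M) = l1 * l2 + l1 * l3 + l2 * l3" "det M = l1 * l2 * l3"
proof -
  have "charpoly M = smult (lead_coeff (charpoly M)) (\<Prod>x\<in>#eigenvalues M. [:-x, 1:])"
    unfolding eigenvalues_def by (rule complex_poly_decompose_multiset[symmetric])
  also have "lead_coeff (charpoly M) = 1"
    by (simp add: charpoly3)
  finally have "charpoly M = [:- l1, 1:] * ([:- l2, 1:] * [:- l3, 1:])"
    by (simp add: assms)
  then show "trace M = l1 + l2 + l3" "trace (adjugate3 M) = l1 * l2 + l1 * l3 + l2 * l3" "det M = l1 * l2 * l3"
    by (auto simp: charpoly3 algebra_simps neg_eq_iff_add_eq_0 add_eq_0_iff)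
qed

text \<open>Up to the factor \<open>c\<close>, the involution fixing \<open>p\<close> and acting as \<open>-1\<close> on the kernel of \<open>q\<close>,
  provided that \<open>q\<close> takes the value \<open>1\<close> on \<open>p\<close>.\<close>

definition reflection :: "'k::comm_ring_1 \<Rightarrow> 'k ^ 'n \<Rightarrow> 'k ^ 'n \<Rightarrow> 'k ^ 'n ^ 'n" where
  "reflection c p q = (\<chi> i j. c * (2 * p$i * q$j - (if i = j then 1 else 0)))"

definition pairing :: "'k::comm_ring_1 ^ 'n \<Rightarrow> 'k ^ 'n \<Rightarrow> 'k" where
  "pairing q x = (\<Sum>i\<in>UNIV. q$i * x$i)"

lemma reflection_apply: "reflection c p q *v x = (2 * c * pairing q x) *s p - c *s x"
proof -
  have "(reflection c p q *v x) $ i = ((2 * c * pairing q x) *s p - c *s x) $ i" for i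
  proof -
    have "(reflection c p q *v x) $ i =
        (\<Sum>j\<in>UNIV. 2 * c * p$i * (q$j * x$j) - c * (if i = j then x$j else 0))"
      by (auto simp: reflection_def matrix_vector_mult_def algebra_simps intro!: sum.cong)
    also have "\<dots> = 2 * c * p$i * pairing q x - c * x$i"
      by (simp add: sum_subtractf pairing_def flip: sum_distrib_left)
    finally show ?thesis by (simp add: algebra_simps)
  qed
  then show ?thesis by (simp add: vec_eq_iff)
qed

lemma trace_reflection_mult:
  "trace (reflection c p q ** M) = c * (2 * pairing q (M *v p) - trace (M :: 'k::comm_ring_1 ^ 3 ^ 3))"
  by (simp add: trace_def reflection_def pairing_def matrix_matrix_mult_def matrix_vector_mult_def
      sum_3 algebra_simps)

lemma det_reflection:
  fixes p q :: "'k::comm_ring_1 ^ 3"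
  shows "det (reflection c p q) = c ^ 3 * (2 * pairing q p - 1)"
  by (simp add: reflection_def pairing_def det_3 sum_3 algebra_simps power3_eq_cube)

text \<open>As \<open>T ** T\<close> is \<open>d\<^sup>2\<close>, the map \<open>T + d\<close> takes
  every vector into the eigenspace of \<open>d\<close>. If this is at most a line, all columns of
  \<open>T + d\<close> are multiples of one vector \<open>p\<close>, and \<open>T + d\<close> has
  rank at most one.\<close>

lemma reflection_of_eigenline:
  fixes T :: "complex ^ 'n ^ 'n"
  assumes sq: "T ** T = mat (d\<^sup>2)" and d: "d \<noteq> 0"
    and line: "vec.dim {x. T *v x = d *s x} \<le> 1"
    and nonscalar: "\<And>k. T \<noteq> mat k"
  obtains p q where "T = reflection d p q" "pairing q p = 1"
proof -
  let ?E = "{x. T *v x = d *s x}"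
  have TT: "T *v (T *v x) = d\<^sup>2 *s x" for x
    using sq by (simp add: matrix_vector_mul_assoc)
  have E: "T *v x + d *s x \<in> ?E" for x
    by (simp add: TT matrix_vector_right_distrib vec.scale vector_add_ldistrib power2_eq_square add.commute)
  obtain B where B: "B \<subseteq> ?E" "vec.independent B" "?E \<subseteq> vec.span B" "card B = vec.dim ?E"
    using vec.basis_exists by blast
  have "finite B" using B(2) by (rule vec.finiteI_independent)
  \<comment> \<open>At this point \<open>B\<close> may still be empty and \<open>p\<close>
    arbitrary. That case would make \<open>T\<close> the scalar \<open>-d\<close> and is excluded
    below by \<open>nonscalar\<close>.\<close>
  obtain p where p: "B \<subseteq> {p}"
    using \<open>finite B\<close> B(4) line by (metis card_le_Suc0_iff_eq One_nat_def empty_subsetI subsetI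
      all_not_in_conv singleton_iff)
  then have Ep: "?E \<subseteq> vec.span {p}"
    using B(3) vec.span_mono[OF p] by blast
  then have "\<exists>k. T *v axis j 1 + d *s axis j 1 = k *s p" for j
    using subsetD[OF Ep E[of "axis j 1"]] by (auto simp: vec.span_singleton)
  then obtain k where k: "\<And>j. T *v axis j 1 + d *s axis j 1 = k j *s p"
    by metis
  \<comment> \<open>The divisor matches the factor \<open>2 * c\<close> that
    \<open>reflection\<close> puts in front of the rank one part.\<close>
  define q where "q = (\<chi> j. k j / (2 * d))"
  have T: "T = reflection d p q"
  proof -
    have "T $ i $ j + (if i = j then d else 0) = k j * p $ i" for i j
    proof -
      have "(T *v axis j 1) $ i = T $ i $ j"
        by (simp add: matrix_vector_mult_def axis_def if_distrib cong: if_cong)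
      moreover have "(axis j 1 :: complex ^ 'n) $ i = (if i = j then 1 else 0)"
        by (simp add: axis_def)
      ultimately show ?thesis
        using arg_cong[OF k, of "\<lambda>v. v $ i" j] by (simp split: if_splits)
    qed
    moreover have "k j = 2 * d * q $ j" for j
      using d by (simp add: q_def)
    ultimately have "T $ i $ j = 2 * d * q $ j * p $ i - (if i = j then d else 0)" for i j
      by (simp only: eq_diff_eq)
    then show ?thesis
      by (simp add: vec_eq_iff reflection_def right_diff_distrib mult_ac)
  qed
  have "p \<in> ?E" "p \<noteq> 0"
  proof -
    have "B \<noteq> {}"
    proof
      assume "B = {}"
      then have "?E \<subseteq> {0}" using B(3) by simp
      from subsetD[OF this E] have "T *v x + d *s x = 0" for x
        by simp
      then have "T *v x = mat (- d) *v x" for x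
        by (simp add: eq_neg_iff_add_eq_0)
      then show False
        using nonscalar[of "- d"] by (metis matrix_eq)
    qed
    with p have "B = {p}" by blast
    with B show "p \<in> ?E" "p \<noteq> 0" by (auto simp: vec.dependent_single)
  qed
  then have "d *s p = (2 * d * pairing q p) *s p - d *s p"
    using reflection_apply[of d p q p] by (simp add: T)
  moreover obtain i where "p $ i \<noteq> 0"
    using \<open>p \<noteq> 0\<close> by (auto simp: vec_eq_iff)
  ultimately have "d * p $ i = 2 * d * pairing q p * p $ i - d * p $ i"
    by (metis (no_types, lifting) vector_minus_component vector_smult_component mult.assoc)
  then have "(d * p $ i) * (2 * pairing q p - 2) = 0"
    by (simp add: algebra_simps)
  with d \<open>p $ i \<noteq> 0\<close> have "pairing q p = 1" by simp
  with T show ?thesis by (rule that)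
qed

text \<open>The two eigenspaces of the square root \<open>T\<close> of a scalar are independent, so in dimension three
  one of them is at most a line.\<close>

lemma scalar_square_reflection:
  fixes T :: "complex ^ 3 ^ 3"
  assumes sq: "T ** T = mat d" and "d \<noteq> 0" and nonscalar: "\<And>k. T \<noteq> mat k"
  obtains c p q where "c\<^sup>2 = d" "T = reflection c p q" "pairing q p = 1"
proof -
  define c where "c = csqrt d"
  have c: "c\<^sup>2 = d" "c \<noteq> 0"
    using \<open>d \<noteq> 0\<close> by (auto simp: c_def)
  let ?E = "\<lambda>c. {x. T *v x = c *s x}"
  have sub: "vec.subspace (?E c)" for c
    by (auto simp: vec.subspace_def matrix_vector_right_distrib vector_add_ldistrib vec.scale mult.commute)
  have Int: "?E c \<inter> ?E (- c) = {0}"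
    using c(2) by (auto simp: vec_eq_iff)
  have "vec.dim (?E c) + vec.dim (?E (- c)) \<le> 3"
    using vec.dim_sums_Int[OF sub sub, of c "- c", unfolded Int]
      dim_subset_UNIV_cart_gen[of "{x + y |x y. x \<in> ?E c \<and> y \<in> ?E (- c)}"]
    by simp
  then consider "vec.dim (?E c) \<le> 1" | "vec.dim (?E (- c)) \<le> 1" by linarith
  then show ?thesis
  proof cases
    case 1
    then show ?thesis
      using reflection_of_eigenline[of T c] sq c nonscalar that by metis
  next
    \<comment> \<open>Here the root of \<open>d\<close> that is returned is \<open>-c\<close>: the
      lemma leaves the sign open.\<close>
    case 2
    then show ?thesis
      using reflection_of_eigenline[of T "- c"] sq c nonscalar that
      by (metis neg_equal_0_iff_equal power2_minus)
  qed
qed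

lemma mat_mult_left_cancel:
  fixes M N :: "'k::field ^ 'n ^ 'm"
  assumes "c \<noteq> 0" "mat c ** M = mat c ** N"
  shows "M = N"
  using assms by (simp add: mat_mult_matrix vec_eq_iff)

lemma pairing_scale [simp]: "pairing q (c *s x) = c * pairing q x"
  and pairing_add [simp]: "pairing q (x + y) = pairing q x + pairing q y"
  and pairing_diff [simp]: "pairing q (x - y) = pairing q x - pairing q y"
  by (simp_all add: pairing_def sum.distrib sum_subtractf sum_distrib_left algebra_simps)

lemma reflection_square:
  fixes p q :: "'k::comm_ring_1 ^ 'n"
  assumes "pairing q p = 1"
  shows "reflection c p q ** reflection c p q = mat (c\<^sup>2)"
proof -
  have "(reflection c p q ** reflection c p q) *v x = mat (c\<^sup>2) *v x" for x
    by (simp add: reflection_apply assms flip: matrix_vector_mul_assoc)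
       (simp add: vec_eq_iff algebra_simps power2_eq_square)
  then show ?thesis by (simp add: matrix_eq)
qed

section \<open>Braided pairs of matrices\<close>

text \<open>An eigenspace of \<open>Z\<close> is invariant under every matrix commuting with
  \<open>Z\<close>, so by irreducibility it is the whole space.\<close>

lemma schur:
  fixes X Y Z :: "complex ^ 3 ^ 3"
  assumes irr: "irreducible_pair X Y" and comm: "Z ** X = X ** Z" "Z ** Y = Y ** Z"
  obtains d where "Z = mat d"
proof -
  obtain d v where v: "v \<noteq> 0" "Z *v v = d *s v" by (rule eigenvector_exists)
  let ?E = "{x. Z *v x = d *s x}"
  have "vec.subspace ?E"
    by (auto simp: vec.subspace_def matrix_vector_right_distrib vector_add_ldistrib vec.scale mult.commute)
  moreover have "invariant_under M ?E" if "Z ** M = M ** Z" for M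
  proof -
    have "Z *v (M *v x) = M *v (Z *v x)" for x
      by (simp add: matrix_vector_mul_assoc that)
    then show ?thesis by (simp add: invariant_under_def vec.scale)
  qed
  ultimately have "?E = UNIV"
    using irreducible_pairD[OF irr, of ?E] comm v by blast
  then have "Z *v x = mat d *v x" for x by auto
  then show ?thesis by (intro that[of d]) (simp add: matrix_eq)
qed

text \<open>\<open>vector\<close> lists rows; the transposition makes the three vectors the columns
  of a change of basis.\<close>

definition cyclic3 :: "'k::comm_ring_1 ^ 3 \<Rightarrow> 'k ^ 3 ^ 3 \<Rightarrow> 'k ^ 3 ^ 3" where
  "cyclic3 p S = transpose (vector [p, S *v p, S *v (S *v p)])"

text \<open>The companion matrix of \<open>x^3 - d\<close>.\<close>

definition companion3 :: "'k::comm_ring_1 \<Rightarrow> 'k ^ 3 ^ 3" where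
  "companion3 d = vector [vector [0, 0, d], vector [1, 0, 0], vector [0, 1, 0]]"

text \<open>The form of \<open>reflection c p q\<close> on the columns of \<open>cyclic3 p S\<close>
  when \<open>q\<close> takes the values \<open>1\<close>, \<open>a\<close>, \<open>b\<close> on
  them.\<close>

definition cyclic_reflection :: "'k::comm_ring_1 \<Rightarrow> 'k \<Rightarrow> 'k \<Rightarrow> 'k ^ 3 ^ 3" where
  "cyclic_reflection c a b = vector [vector [c, 2 * c * a, 2 * c * b], vector [0, -c, 0], vector [0, 0, -c]]"

lemma cyclic3_apply:
  "cyclic3 p S *v x = x$1 *s p + x$2 *s (S *v p) + x$3 *s (S *v (S *v p))"
  by (simp add: cyclic3_def transpose_def vec_eq_iff forall_3 matrix_vector_mult_def sum_3 algebra_simps)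

lemma cyclic3_companion:
  fixes S :: "'k::field ^ 3 ^ 3"
  assumes "S ** S ** S = mat d"
  shows "S ** cyclic3 p S = cyclic3 p S ** companion3 d"
proof -
  have "S *v (S *v (S *v p)) = d *s p"
    using arg_cong[OF assms, of "\<lambda>M. M *v p"] by (simp flip: matrix_vector_mul_assoc)
  then have "(S ** cyclic3 p S) *v x = (cyclic3 p S ** companion3 d) *v x" for x
    by (simp add: cyclic3_apply matrix_vector_right_distrib vec.scale flip: matrix_vector_mul_assoc)
       (simp add: companion3_def matrix_vector_mult_def sum_3 algebra_simps)
  then show ?thesis by (simp add: matrix_eq)
qed

lemma cyclic3_reflection:
  fixes S :: "'k::field ^ 3 ^ 3"
  assumes "pairing q p = 1"
  shows "reflection c p q ** cyclic3 p S =
    cyclic3 p S ** cyclic_reflection c (pairing q (S *v p)) (pairing q (S *v (S *v p)))"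
proof -
  let ?D = "cyclic_reflection c (pairing q (S *v p)) (pairing q (S *v (S *v p)))"
  have "(reflection c p q ** cyclic3 p S) *v x = (cyclic3 p S ** ?D) *v x" for x
    by (simp add: cyclic3_apply reflection_apply assms flip: matrix_vector_mul_assoc)
       (simp add: vec_eq_iff cyclic_reflection_def matrix_vector_mult_def sum_3 algebra_simps)
  then show ?thesis by (simp add: matrix_eq)
qed

locale braid_pair =
  fixes X Y :: "'k::field ^ 'n ^ 'n"
  assumes braid: "X ** Y ** X = Y ** X ** Y"
begin

abbreviation "S \<equiv> X ** Y"
abbreviation "T \<equiv> X ** Y ** X"

text \<open>Moving \<open>T\<close> past a generator exchanges \<open>X\<close> and
  \<open>Y\<close>, so \<open>T ** T\<close> commutes with both.\<close>

lemma T_X: "T ** X = Y ** T" and X_T: "X ** T = T ** Y"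
proof -
  have "T ** X = Y ** X ** Y ** X" by (simp only: braid)
  then show "T ** X = Y ** T" by (simp only: matrix_mul_assoc)
  have "X ** T = X ** (Y ** X ** Y)" by (simp only: braid)
  then show "X ** T = T ** Y" by (simp only: matrix_mul_assoc)
qed

lemma S_cubed: "S ** S ** S = T ** T"
proof -
  have "S ** S ** S = T ** (Y ** X ** Y)" by (simp only: matrix_mul_assoc)
  then show ?thesis by (simp only: braid)
qed

lemma T_X_T: "T ** X ** T = T ** T ** Y"
  by (metis X_T matrix_mul_assoc)

lemma T_squared_X: "T ** T ** X = X ** (T ** T)" and T_squared_Y: "T ** T ** Y = Y ** (T ** T)"
proof -
  have "T ** T ** X = T ** (T ** X)" by (rule matrix_mul_assoc[symmetric])
  also have "\<dots> = T ** Y ** T" unfolding T_X by (rule matrix_mul_assoc)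
  also have "\<dots> = X ** (T ** T)" unfolding X_T[symmetric] by (rule matrix_mul_assoc[symmetric])
  finally show "T ** T ** X = X ** (T ** T)" .
  have "T ** T ** Y = T ** X ** T" by (rule T_X_T[symmetric])
  also have "\<dots> = Y ** (T ** T)" unfolding T_X by (rule matrix_mul_assoc[symmetric])
  finally show "T ** T ** Y = Y ** (T ** T)" .
qed

text \<open>Uses \<open>T = S ** X\<close>. Once \<open>T ** T\<close> is a nonzero scalar, this
  recovers \<open>X\<close> from \<open>S\<close> and \<open>T\<close>, and \<open>T_X_T\<close>
  then recovers \<open>Y\<close>.\<close>

lemma S_S_T: "S ** S ** T = T ** T ** X"
proof -
  have "S ** S ** T = S ** S ** S ** X" by (simp only: matrix_mul_assoc)
  then show ?thesis by (simp only: S_cubed)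
qed

end

section \<open>Intertwiners between braided pairs\<close>

lemma conjugate_trace:
  fixes M N K :: "'k::field ^ 'n ^ 'n"
  assumes "invertible K" "M ** K = K ** N"
  shows "trace M = trace N"
proof -
  obtain K' where K': "K ** K' = mat 1" "K' ** K = mat 1"
    using assms(1) by (auto simp: invertible_def)
  have "trace M = trace (M ** K ** K')" by (simp add: K' flip: matrix_mul_assoc)
  also have "\<dots> = trace (K' ** (K ** N))" unfolding assms(2) by (rule trace_mul_sym)
  also have "\<dots> = trace N" by (simp add: K' matrix_mul_assoc)
  finally show ?thesis .
qed

text \<open>\<open>K' ** L\<close> carries the columns of \<open>K\<close> to those of
  \<open>K'\<close>, and \<open>M\<close> and \<open>M'\<close> act on these columns by the same
  matrix \<open>N\<close>.\<close>

lemma intertwiner_of_common_form: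
  fixes K K' L M M' N :: "'k::field ^ 'n ^ 'n"
  assumes "K ** L = mat 1" "L ** K = mat 1" "M ** K = K ** N" "M' ** K' = K' ** N"
  shows "(K' ** L) ** M = M' ** (K' ** L)"
proof -
  have "(K' ** L) ** M = K' ** L ** (M ** K) ** L"
    using assms(1) by (simp flip: matrix_mul_assoc)
  also have "\<dots> = K' ** (L ** K) ** N ** L"
    unfolding assms(3) by (simp only: matrix_mul_assoc)
  also have "\<dots> = M' ** K' ** L"
    unfolding assms(2,4) by simp
  finally show ?thesis by (simp only: matrix_mul_assoc)
qed

lemma intertwiner_mult:
  assumes "L ** M = M' ** L" "L ** N = N' ** L"
  shows "L ** (M ** N) = (M' ** N') ** L"
  by (metis assms matrix_mul_assoc)

locale reflected_braid_pair = braid_pair X Y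
  for X Y :: "'k::field ^ 3 ^ 3" +
  fixes t :: 'k and p q :: "'k ^ 3"
  assumes T_reflection: "T = reflection t p q" and pairing: "pairing q p = 1" and t: "t \<noteq> 0"
begin

lemma T_squared: "T ** T = mat (t\<^sup>2)"
  unfolding T_reflection by (rule reflection_square[OF pairing])

lemma S_cyclic3: "S ** cyclic3 p S = cyclic3 p S ** companion3 (t\<^sup>2)"
  by (rule cyclic3_companion) (simp only: S_cubed T_squared)

end

text \<open>By the two equations on pairings, \<open>S\<close> and \<open>T\<close> have the same
  matrices on the cyclic triples of both pairs, so mapping one triple to the other intertwines them.
  The generators follow because they are recovered from \<open>S\<close> and \<open>T\<close>. The
  condition \<open>L *v p = p'\<close> serves to show that \<open>L\<close> is nonzero.\<close>

lemma cyclic_intertwiner: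
  fixes X Y X' Y' :: "'k::field ^ 3 ^ 3"
  assumes "reflected_braid_pair X Y t p q" "reflected_braid_pair X' Y' t p' q'"
    and K: "invertible (cyclic3 p (X ** Y))"
    and S: "pairing q ((X ** Y) *v p) = pairing q' ((X' ** Y') *v p')"
    and SS: "pairing q ((X ** Y) *v ((X ** Y) *v p)) = pairing q' ((X' ** Y') *v ((X' ** Y') *v p'))"
  obtains L where "L ** X = X' ** L" "L ** Y = Y' ** L" "L *v p = p'"
proof -
  interpret A: reflected_braid_pair X Y t p q by fact
  interpret B: reflected_braid_pair X' Y' t p' q' by fact
  let ?K = "cyclic3 p A.S" and ?K' = "cyclic3 p' B.S"
  obtain K' where K': "?K ** K' = mat 1" "K' ** ?K = mat 1"
    using K by (auto simp: invertible_def)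
  define L where "L = ?K' ** K'"
  have LS: "L ** A.S = B.S ** L"
    unfolding L_def by (rule intertwiner_of_common_form[OF K' A.S_cyclic3 B.S_cyclic3])
  have LT: "L ** A.T = B.T ** L"
    unfolding L_def A.T_reflection B.T_reflection
    by (rule intertwiner_of_common_form[OF K' cyclic3_reflection[OF A.pairing]])
       (simp only: cyclic3_reflection[OF B.pairing] S SS)
  \<comment> \<open>\<open>mat (t\<^sup>2) ** X\<close> is the product \<open>S ** S ** T\<close>,
    which \<open>L\<close> already intertwines.\<close>
  have "L ** (mat (t\<^sup>2) ** X) = (mat (t\<^sup>2) ** X') ** L"
    unfolding A.T_squared[symmetric] A.S_S_T[symmetric]
    unfolding A.T_squared B.T_squared[symmetric] B.S_S_T[symmetric]
    by (intro intertwiner_mult LS LT)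
  then have "mat (t\<^sup>2) ** (L ** X) = mat (t\<^sup>2) ** (X' ** L)"
    by (metis matrix_mul_assoc matrix_mult_mat)
  then have LX: "L ** X = X' ** L"
    by (rule mat_mult_left_cancel[rotated]) (use A.t in simp)
  have "L ** (A.T ** X ** A.T) = (B.T ** X' ** B.T) ** L"
    by (intro intertwiner_mult LX LT)
  then have "L ** (mat (t\<^sup>2) ** Y) = (mat (t\<^sup>2) ** Y') ** L"
    unfolding A.T_X_T B.T_X_T A.T_squared B.T_squared .
  then have "mat (t\<^sup>2) ** (L ** Y) = mat (t\<^sup>2) ** (Y' ** L)"
    by (metis matrix_mul_assoc matrix_mult_mat)
  then have LY: "L ** Y = Y' ** L"
    by (rule mat_mult_left_cancel[rotated]) (use A.t in simp)
  have axis: "cyclic3 p S *v axis 1 1 = p" for p :: "'k ^ 3" and S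
    by (simp add: cyclic3_apply axis_def)
  have "L *v p = ?K' *v ((K' ** ?K) *v axis 1 1)"
    by (simp add: L_def axis flip: matrix_vector_mul_assoc)
  then have "L *v p = p'"
    by (simp add: K' axis)
  with LX LY show ?thesis by (rule that)
qed

section \<open>The normal form of an irreducible pair\<close>

lemma invariant_under_mult:
  "invariant_under M W \<Longrightarrow> invariant_under N W \<Longrightarrow> invariant_under (M ** N) W"
  by (simp add: invariant_under_def flip: matrix_vector_mul_assoc)

lemma invariant_under_mat_multD:
  assumes "invariant_under (mat c ** M) W" "vec.subspace W" "c \<noteq> 0"
  shows "invariant_under M W"
  unfolding invariant_under_def
proof
  fix w assume "w \<in> W"
  then have "c *s (M *v w) \<in> W"
    using assms(1) by (simp add: invariant_under_def flip: matrix_vector_mul_assoc)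
  then have "inverse c *s (c *s (M *v w)) \<in> W"
    by (rule vec.subspace_scale[OF assms(2)])
  then show "M *v w \<in> W" using assms(3) by simp
qed

text \<open>The column space contains \<open>p\<close>, which is nonzero, and is invariant under
  \<open>S\<close> and \<open>T\<close>, hence under \<open>X\<close> and \<open>Y\<close>;
  irreducibility makes it everything.\<close>

lemma (in reflected_braid_pair) cyclic3_invertible:
  assumes "irreducible_pair X Y"
  shows "invertible (cyclic3 p S)"
proof -
  let ?K = "cyclic3 p S"
  let ?W = "range ((*v) ?K)"
  have W: "vec.subspace ?W"
    by (rule vec.subspace_image) simp
  have inv: "invariant_under M ?W" if "M ** ?K = ?K ** N" for M N
    unfolding invariant_under_def
    by (auto simp: matrix_vector_mul_assoc that) (simp flip: matrix_vector_mul_assoc)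
  have WS: "invariant_under S ?W"
    by (rule inv[OF S_cyclic3])
  have WT: "invariant_under T ?W"
    unfolding T_reflection by (rule inv[OF cyclic3_reflection[OF pairing]])
  have "invariant_under (mat (t\<^sup>2) ** X) ?W"
    unfolding T_squared[symmetric] S_S_T[symmetric] by (intro invariant_under_mult WS WT)
  then have WX: "invariant_under X ?W"
    using W by (rule invariant_under_mat_multD) (simp add: t)
  have "invariant_under (mat (t\<^sup>2) ** Y) ?W"
    unfolding T_squared[symmetric] T_X_T[symmetric] by (intro invariant_under_mult WX WT)
  then have WY: "invariant_under Y ?W"
    using W by (rule invariant_under_mat_multD) (simp add: t)
  have "p = ?K *v axis 1 1"
    by (simp add: cyclic3_apply axis_def)
  moreover have "p \<noteq> 0"
    using pairing by (auto simp: pairing_def)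
  ultimately have "?W \<noteq> {0}" by blast
  then have "?W = UNIV"
    by (rule irreducible_pairD[OF assms W WX WY])
  then show ?thesis
    unfolding invertible_right_inverse matrix_right_invertible_surjective .
qed

text \<open>Determinants identify the factor of the reflection as \<open>det X\<close>; the traces
  of \<open>T ** S\<close> and \<open>T ** (S ** S)\<close> give the two pairings, because
  \<open>S\<close> and \<open>S ** S\<close> have trace zero.\<close>

lemma irreducible_braid_pair_reflected:
  fixes X Y :: "complex ^ 3 ^ 3"
  assumes irr: "irreducible_pair X Y" and "braid_pair X Y" and "invertible X" "invertible Y"
  obtains p q where "reflected_braid_pair X Y (det X) p q"
    "2 * pairing q ((X ** Y) *v p) = trace (adjugate3 X)"
    "2 * pairing q ((X ** Y) *v ((X ** Y) *v p)) = det X * trace X"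
proof -
  interpret braid_pair X Y by fact
  let ?t = "det X"
  have det0: "?t \<noteq> 0" "det Y \<noteq> 0"
    using assms(3,4) by (simp_all add: invertible_det_nz)
  have detY: "det Y = ?t"
    using arg_cong[OF braid, of det] det0 by (simp add: det_mul)
  \<comment> \<open>A scalar \<open>T\<close> would force \<open>X = Y\<close>, and then the line of
    an eigenvector would be invariant.\<close>
  have nonscalar: "T \<noteq> mat k" for k
  proof
    assume k: "T = mat k"
    have "det T \<noteq> 0" using det0 by (simp add: det_mul)
    then have "k \<noteq> 0" unfolding k by (auto simp: det_3 mat_def)
    moreover have "mat k ** X = mat k ** Y"
      using T_X unfolding k matrix_mult_mat .
    ultimately have XY: "X = Y" by (rule mat_mult_left_cancel)
    obtain x v where v: "v \<noteq> 0" "X *v v = x *s v" by (rule eigenvector_exists)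
    have "invariant_under X (vec.span {v})"
      by (auto simp: invariant_under_def vec.span_singleton vec.scale v)
    moreover have "vec.span {v} \<noteq> {0}"
      using v(1) vec.span_base[of v "{v}"] by auto
    ultimately have "vec.span {v} = UNIV"
      using irreducible_pairD[OF irr vec.subspace_span] XY by blast
    then have "vec.dim (UNIV :: (complex ^ 3) set) \<le> card {v}"
      by (intro vec.dim_le_card) auto
    then show False
      unfolding vec_dim_card by simp
  qed
  obtain d where d: "T ** T = mat d"
    by (rule schur[OF irr T_squared_X T_squared_Y])
  have "det (T ** T) \<noteq> 0" using det0 by (simp add: det_mul)
  then have "d \<noteq> 0" unfolding d by (auto simp: det_3 mat_def)
  then obtain c p q where cpq: "c\<^sup>2 = d" "T = reflection c p q" "pairing q p = 1"
    using scalar_square_reflection[OF d] nonscalar by metis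
  interpret reflected_braid_pair X Y c p q
    using cpq \<open>d \<noteq> 0\<close> by unfold_locales auto
  have K: "invertible (cyclic3 p S)"
    by (rule cyclic3_invertible[OF irr])
  have "det S * det (cyclic3 p S) = det (cyclic3 p S) * d"
    using arg_cong[OF S_cyclic3, of det] cpq(1)
    by (simp add: det_mul) (simp add: companion3_def det_3)
  then have "det S = d"
    using K by (simp add: invertible_det_nz)
  then have c2: "c\<^sup>2 = ?t\<^sup>2"
    using cpq(1) by (simp add: det_mul detY power2_eq_square)
  \<comment> \<open>The squares determine \<open>c\<close> only up to sign; the determinant of
    \<open>T\<close> supplies the cubes and so fixes the sign.\<close>
  have c3: "c ^ 3 = ?t ^ 3"
    using arg_cong[OF T_reflection, of det]
    by (simp add: det_mul detY det_reflection pairing power3_eq_cube)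
  have "c * c\<^sup>2 = ?t * c\<^sup>2"
    using c2 c3 by (simp add: power2_eq_square power3_eq_cube)
  then have c: "c = ?t" using t by simp
  have trS: "trace S = 0"
    using conjugate_trace[OF K S_cyclic3] by (simp add: companion3_def trace_def sum_3)
  have "S ** S ** cyclic3 p S = cyclic3 p S ** (companion3 (c\<^sup>2) ** companion3 (c\<^sup>2))"
    by (metis S_cyclic3 matrix_mul_assoc)
  from conjugate_trace[OF K this] have trSS: "trace (S ** S) = 0"
    by (simp add: companion3_def trace_def sum_3 matrix_matrix_mult_def)
  \<comment> \<open>Since \<open>S ** X = T\<close>, the left side is
    \<open>T ** T ** adjugate3 X\<close>; on the other hand \<open>X ** adjugate3 X\<close> is the
    scalar \<open>det X\<close>.\<close>
  have "T ** S ** (X ** adjugate3 X) = mat (?t\<^sup>2) ** adjugate3 X"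
    using T_squared by (simp add: matrix_mul_assoc c)
  then have "mat ?t ** (T ** S) = mat (?t\<^sup>2) ** adjugate3 X"
    by (simp only: mult_adjugate3 matrix_mult_mat)
  from arg_cong[OF this, of trace] have "?t * trace (T ** S) = ?t\<^sup>2 * trace (adjugate3 X)"
    by (simp only: trace_mat_mult)
  then have "?t * (?t * (2 * pairing q (S *v p))) = ?t\<^sup>2 * trace (adjugate3 X)"
    by (simp only: T_reflection trace_reflection_mult trS c diff_0_right)
  then have 1: "2 * pairing q (S *v p) = trace (adjugate3 X)"
    using det0 by (simp add: power2_eq_square)
  \<comment> \<open>Cyclicity of the trace turns the argument into
    \<open>S ** S ** T\<close>.\<close>
  have "trace (T ** (S ** S)) = trace (mat (?t\<^sup>2) ** X)"
    using S_S_T T_squared by (metis trace_mul_sym c)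
  then have "?t * (2 * pairing q ((S ** S) *v p)) = ?t\<^sup>2 * trace X"
    by (simp only: T_reflection trace_reflection_mult trSS c diff_0_right trace_mat_mult)
  then have 2: "2 * pairing q (S *v (S *v p)) = ?t * trace X"
    using det0 by (simp add: power2_eq_square matrix_vector_mul_assoc)
  from 1 2 show ?thesis
    using that reflected_braid_pair_axioms c by blast
qed

section \<open>The matrices A and B\<close>

lemma matA_matB_products:
  "matA l1 l2 l3 ** matB l1 l2 l3 ** matA l1 l2 l3 =
     vector [vector [0, 0, l1 * l2 * l3], vector [0, - (l1 * l2 * l3), 0], vector [l1 * l2 * l3, 0, 0]]"
  "matB l1 l2 l3 ** matA l1 l2 l3 ** matB l1 l2 l3 =
     vector [vector [0, 0, l1 * l2 * l3], vector [0, - (l1 * l2 * l3), 0], vector [l1 * l2 * l3, 0, 0]]"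
  by (simp_all add: matA_def matB_def matrix3_simps algebra_simps power2_eq_square)

lemma invertible_matA: "l1 * l2 * l3 \<noteq> 0 \<Longrightarrow> invertible (matA l1 l2 l3)"
  and invertible_matB: "l1 * l2 * l3 \<noteq> 0 \<Longrightarrow> invertible (matB l1 l2 l3)"
  by (simp_all add: invertible_det_nz det_3 matA_def matB_def)

text \<open>Up to the factor \<open>l1 * l2 * l3\<close>, the triple product swaps \<open>e1\<close>
  and \<open>e3\<close> and negates \<open>e2\<close>; its fixed line is spanned by
  \<open>e1 + e3\<close>.\<close>

lemma reflected_braid_pair_matA_matB:
  assumes "l1 * l2 * l3 \<noteq> 0"
  shows "reflected_braid_pair (matA l1 l2 l3) (matB l1 l2 l3) (l1 * l2 * l3)
    (vector [1, 0, 1]) (vector [1 / 2, 0, 1 / 2])"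
proof
  show "matA l1 l2 l3 ** matB l1 l2 l3 ** matA l1 l2 l3 = matB l1 l2 l3 ** matA l1 l2 l3 ** matB l1 l2 l3"
    by (simp only: matA_matB_products)
  show "matA l1 l2 l3 ** matB l1 l2 l3 ** matA l1 l2 l3 =
      reflection (l1 * l2 * l3) (vector [1, 0, 1]) (vector [1 / 2, 0, 1 / 2])"
    unfolding matA_matB_products by (simp add: reflection_def vec_eq_iff forall_3)
  show "pairing (vector [1 / 2, 0, 1 / 2] :: complex ^ 3) (vector [1, 0, 1]) = 1"
    by (simp add: pairing_def sum_3)
qed fact

text \<open>These values agree with those of \<open>irreducible_braid_pair_reflected\<close> for a
  generator with eigenvalues \<open>l1\<close>, \<open>l2\<close>, \<open>l3\<close>.\<close>

lemma pairing_matA_matB: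
  fixes l1 l2 l3 :: complex
  defines "p \<equiv> vector [1, 0, 1]" and "S \<equiv> matA l1 l2 l3 ** matB l1 l2 l3"
  shows "2 * pairing (vector [1 / 2, 0, 1 / 2]) (S *v p) = l1 * l2 + l1 * l3 + l2 * l3"
    and "2 * pairing (vector [1 / 2, 0, 1 / 2]) (S *v (S *v p)) = (l1 * l2 * l3) * (l1 + l2 + l3)"
  by (simp_all add: p_def S_def pairing_def matA_def matB_def matrix_matrix_mult_def
      matrix_vector_mult_def sum_3 field_simps power2_eq_square)

text \<open>The kernel of the intertwiner is invariant and does not contain \<open>p\<close>, so it
  is zero. This also lets invariant subspaces of the explicit pair be pulled back to
  \<open>X\<close> and \<open>Y\<close>.\<close>

lemma irreducible_braid_pair_equivalent:
  fixes X Y :: "complex ^ 3 ^ 3"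
  assumes irr: "irreducible_pair X Y" and "braid_pair X Y" "invertible X" "invertible Y"
    and ev: "eigenvalues X = {#l1, l2, l3#}"
  shows "\<exists>L. invertible L \<and> L ** X = matA l1 l2 l3 ** L \<and> L ** Y = matB l1 l2 l3 ** L"
    and "l2\<^sup>2 + l1 * l3 \<noteq> 0"
proof -
  note ev = eigenvalues3[OF ev]
  have t: "l1 * l2 * l3 \<noteq> 0"
    using \<open>invertible X\<close> by (simp add: invertible_det_nz ev(3))
  let ?p' = "vector [1, 0, 1] :: complex ^ 3"
  obtain p q where pq: "reflected_braid_pair X Y (l1 * l2 * l3) p q"
    "2 * pairing q ((X ** Y) *v p) = l1 * l2 + l1 * l3 + l2 * l3"
    "2 * pairing q ((X ** Y) *v ((X ** Y) *v p)) = (l1 * l2 * l3) * (l1 + l2 + l3)"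
    using irreducible_braid_pair_reflected[OF assms(1-4)] unfolding ev by blast
  have "invertible (cyclic3 p (X ** Y))"
    by (rule reflected_braid_pair.cyclic3_invertible[OF pq(1) irr])
  moreover note pq(2)[folded pairing_matA_matB(1)] pq(3)[folded pairing_matA_matB(2)]
  ultimately obtain L where L: "L ** X = matA l1 l2 l3 ** L" "L ** Y = matB l1 l2 l3 ** L" "L *v p = ?p'"
    using cyclic_intertwiner[OF pq(1) reflected_braid_pair_matA_matB[OF t]] by auto
  have LX: "L *v (X *v x) = matA l1 l2 l3 *v (L *v x)"
    and LY: "L *v (Y *v x) = matB l1 l2 l3 *v (L *v x)" for x
    by (simp_all add: matrix_vector_mul_assoc L)
  have p': "?p' \<noteq> 0"
    by (simp add: vec_eq_iff forall_3)
  have "vec.subspace {x. L *v x = 0}"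
    by (auto simp: vec.subspace_def matrix_vector_right_distrib vec.scale)
  moreover have "invariant_under X {x. L *v x = 0}" "invariant_under Y {x. L *v x = 0}"
    by (simp_all add: invariant_under_def LX LY)
  moreover have "{x. L *v x = 0} \<noteq> UNIV"
  proof
    assume "{x. L *v x = 0} = UNIV"
    then have "p \<in> {x. L *v x = 0}" by (rule ssubst) (rule UNIV_I)
    then show False using L(3) p' by simp
  qed
  ultimately have "{x. L *v x = 0} = {0}"
    using irreducible_pairD[OF irr] by blast
  then have inv: "invertible L"
    unfolding invertible_left_inverse matrix_left_invertible_ker by blast
  with L show "\<exists>L. invertible L \<and> L ** X = matA l1 l2 l3 ** L \<and> L ** Y = matB l1 l2 l3 ** L"
    by blast
  show "l2\<^sup>2 + l1 * l3 \<noteq> 0"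
  proof
    assume a: "l2\<^sup>2 + l1 * l3 = 0"
    \<comment> \<open>The preimage of the plane spanned by \<open>e1\<close> and \<open>e3\<close>.
      It contains \<open>p\<close>, which \<open>L\<close> maps to \<open>e1 + e3\<close>, and it is
      proper because \<open>L\<close> is onto.\<close>
    let ?W = "{x. (L *v x) $ 2 = 0}"
    have "(matA l1 l2 l3 *v y) $ 2 = (l2\<^sup>2 + l1 * l3) * y $ 1 + l2 * y $ 2"
      "(matB l1 l2 l3 *v y) $ 2 = l2 * y $ 2 - (l2\<^sup>2 + l1 * l3) * y $ 3" for y
      by (simp_all add: matA_def matB_def matrix_vector_mult_def sum_3 algebra_simps)
    then have "invariant_under X ?W" "invariant_under Y ?W"
      by (simp_all add: invariant_under_def LX LY a)
    moreover have "vec.subspace ?W"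
      by (auto simp: vec.subspace_def matrix_vector_right_distrib vec.scale)
    moreover have "?W \<noteq> {0}"
    proof -
      have "p \<in> ?W" "p \<noteq> 0" using L(3) p' by auto
      then show ?thesis by blast
    qed
    ultimately have "?W = UNIV"
      by (intro irreducible_pairD[OF irr])
    from this[THEN equalityD2] have zero: "(L *v x) $ 2 = 0" for x
      by (auto dest: subsetD[of _ _ x])
    obtain x where "L *v x = axis 2 1"
      using inv unfolding invertible_right_inverse matrix_right_invertible_surjective by (metis surjD)
    with zero[of x] show False by simp
  qed
qed

text \<open>The rank one matrices \<open>(A - l1) (A - l2) = u e1\<^sup>T\<close> and \<open>(A - l2) (A - l3) = e3 v\<^sup>T\<close>
  carry a vector with nonzero first coordinate to \<open>u\<close>, and then \<open>J u\<close> to \<open>e3\<close>, where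
  \<open>A B A = l1 l2 l3 J\<close>; the conditions on the eigenvalues enter through \<open>v\<^sup>T J u\<close>.\<close>

lemma irreducible_pair_matA_matB:
  fixes l1 l2 l3 :: complex
  assumes t: "l1 * l2 * l3 \<noteq> 0"
    and ne: "l1\<^sup>2 + l2 * l3 \<noteq> 0" "l2\<^sup>2 + l1 * l3 \<noteq> 0" "l3\<^sup>2 + l1 * l2 \<noteq> 0"
  shows "irreducible_pair (matA l1 l2 l3) (matB l1 l2 l3)"
  unfolding irreducible_pair_def
proof (intro allI impI, elim conjE)
  fix W assume W: "vec.subspace W" and AW: "invariant_under (matA l1 l2 l3) W"
    and BW: "invariant_under (matB l1 l2 l3) W"
  let ?A = "matA l1 l2 l3" and ?B = "matB l1 l2 l3"
  let ?J = "vector [vector [0, 0, 1], vector [0, -1, 0], vector [1, 0, 0]] :: complex ^ 3 ^ 3"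
  \<comment> \<open>The first column of \<open>(A - l1) (A - l2)\<close>; its other columns
    vanish.\<close>
  let ?u = "vector [(l3 - l1) * (l3 - l2), (l2\<^sup>2 + l1 * l3) * (l3 - l1), l3 * (l1 + l2)] :: complex ^ 3"
  have A: "?A *v w \<in> W" and B: "?B *v w \<in> W" if "w \<in> W" for w
    using AW BW that by (auto simp: invariant_under_def)
  have scale: "w \<in> W" if "c *s w \<in> W" "c \<noteq> 0" for c w
    using vec.subspace_scale[OF W that(1), of "inverse c"] that(2) by simp
  \<comment> \<open>The expansion of \<open>(A - a) (A - b) w\<close>.\<close>
  have quadratic: "?A *v (?A *v w) - (a + b) *s (?A *v w) + (a * b) *s w \<in> W" if "w \<in> W" for a b w
    using that by (intro vec.subspace_add vec.subspace_diff vec.subspace_scale W A)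
  have ABA: "?A ** ?B ** ?A = mat (l1 * l2 * l3) ** ?J"
    unfolding matA_matB_products by (simp add: mat_mult_matrix vec_eq_iff forall_3)
  have J: "?J *v w \<in> W" if "w \<in> W" for w
  proof (rule scale[OF _ t])
    have "(?A ** ?B ** ?A) *v w \<in> W"
      using that by (simp add: A B flip: matrix_vector_mul_assoc)
    then show "(l1 * l2 * l3) *s (?J *v w) \<in> W"
      unfolding ABA by (simp flip: matrix_vector_mul_assoc)
  qed
  have first: "?A *v (?A *v w) - (l1 + l2) *s (?A *v w) + (l1 * l2) *s w = w$1 *s ?u" for w
    by (simp add: matA_def matrix_vector_mult_def vec_eq_iff forall_3 sum_3 algebra_simps power2_eq_square)
  have last: "?A *v (?A *v (?J *v ?u)) - (l2 + l3) *s (?A *v (?J *v ?u)) + (l2 * l3) *s (?J *v ?u) =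
      ((l1\<^sup>2 + l2 * l3) * (l3\<^sup>2 + l1 * l2)) *s axis 3 1"
    by (simp add: matA_def matrix_vector_mult_def vec_eq_iff forall_3 sum_3 axis_def)
       (simp add: algebra_simps power2_eq_square)
  show "W = {0} \<or> W = UNIV"
  proof (cases "\<exists>w\<in>W. w $ 1 \<noteq> 0")
    case True
    then obtain w where "w \<in> W" "w $ 1 \<noteq> 0" by blast
    then have "?u \<in> W"
      using quadratic[of w l1 l2] scale unfolding first by blast
    then have e3: "axis 3 1 \<in> W"
      using quadratic[OF J, of ?u l2 l3] ne scale unfolding last by simp
    have "?J *v axis 3 1 = axis 1 1"
      by (simp add: matrix_vector_mult_def vec_eq_iff forall_3 sum_3 axis_def)
    with J[OF e3] have e1: "axis 1 1 \<in> W" by simp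
    \<comment> \<open>The first column of \<open>A\<close> without its outer entries: the middle
      entry is nonzero by assumption and yields \<open>e2\<close>.\<close>
    have "?A *v axis 1 1 - l3 *s axis 1 1 - l2 *s axis 3 1 = (l2\<^sup>2 + l1 * l3) *s axis 2 1"
      by (simp add: matA_def matrix_vector_mult_def vec_eq_iff forall_3 sum_3 axis_def)
    moreover have "?A *v axis 1 1 - l3 *s axis 1 1 - l2 *s axis 3 1 \<in> W"
      by (intro vec.subspace_diff vec.subspace_scale W A e1 e3)
    ultimately have e2: "axis 2 1 \<in> W"
      using scale ne(2) by metis
    have "w \<in> W" for w
    proof -
      have "w = w$1 *s axis 1 1 + w$2 *s axis 2 1 + w$3 *s axis 3 1"
        by (simp add: vec_eq_iff forall_3 axis_def)
      also have "\<dots> \<in> W"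
        by (intro vec.subspace_add vec.subspace_scale W e1 e2 e3)
      finally show ?thesis .
    qed
    then show ?thesis by blast
  next
    case False
    have "w = 0" if w: "w \<in> W" for w
    proof -
      \<comment> \<open>The first coordinates of \<open>w\<close>, \<open>J w\<close> and
        \<open>B w\<close> are \<open>w$1\<close>, \<open>w$3\<close> and
        \<open>l1 * w$1 - w$2 + l2 * w$3\<close>; together they determine \<open>w\<close>.\<close>
      have "w $ 1 = 0" "(?J *v w) $ 1 = 0" "(?B *v w) $ 1 = 0"
        using False w J B by blast+
      then show ?thesis
        by (simp add: matB_def matrix_vector_mult_def vec_eq_iff forall_3 sum_3)
    qed
    then show ?thesis
      using vec.subspace_0[OF W] by blast
  qed
qed

theorem mainTheorem18:
  shows "(\<forall>(\<rho> :: braid_gen gword set \<Rightarrow> complex ^ 3 ^ 3) l1 l2 l3.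
            irreducible_rep B3 \<rho> \<and> eigenvalues (\<rho> s1) = {#l1, l2, l3#} \<longrightarrow>
              (l1\<^sup>2 + l2 * l3) * (l2\<^sup>2 + l1 * l3) * (l3\<^sup>2 + l1 * l2) / (l1 * l2 * l3)\<^sup>2 \<noteq> 0 \<and>
              (\<exists>\<sigma>. rep_with_images \<sigma> (matA l1 l2 l3) (matB l1 l2 l3) \<and> equivalent_rep B3 \<rho> \<sigma>))
       \<and> (\<forall>l1 l2 l3 :: complex.
            l1 \<noteq> 0 \<and> l2 \<noteq> 0 \<and> l3 \<noteq> 0 \<and>
            (l1\<^sup>2 + l2 * l3) * (l2\<^sup>2 + l1 * l3) * (l3\<^sup>2 + l1 * l2) / (l1 * l2 * l3)\<^sup>2 \<noteq> 0 \<longrightarrow>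
              (\<exists>\<sigma>. rep_with_images \<sigma> (matA l1 l2 l3) (matB l1 l2 l3) \<and> irreducible_rep B3 \<sigma>))"
proof -
  have exists: "\<exists>\<sigma>. rep_with_images \<sigma> (matA l1 l2 l3) (matB l1 l2 l3)" if "l1 * l2 * l3 \<noteq> 0" for l1 l2 l3
    using rep_with_images_exists[OF invertible_matA[OF that] invertible_matB[OF that]]
    by (simp only: matA_matB_products) blast
  show ?thesis
  proof (rule conjI; intro allI impI; elim conjE)
    fix \<rho> :: "braid_gen gword set \<Rightarrow> complex ^ 3 ^ 3" and l1 l2 l3 :: complex
    assume irr: "irreducible_rep B3 \<rho>" and ev: "eigenvalues (\<rho> s1) = {#l1, l2, l3#}"
    have rep: "representation B3 \<rho>" using irr by (simp add: irreducible_rep_def)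
    have pair: "irreducible_pair (\<rho> s1) (\<rho> s2)" "braid_pair (\<rho> s1) (\<rho> s2)"
      "invertible (\<rho> s1)" "invertible (\<rho> s2)"
      using irr rep irreducible_rep_iff_pair[OF rep] rep_braid_relation[OF rep] rep_invertible[OF rep]
      by (auto intro: braid_pair.intro)
    note equivalent = irreducible_braid_pair_equivalent[OF pair]
    have t: "l1 * l2 * l3 \<noteq> 0"
      using pair(3) by (simp add: invertible_det_nz eigenvalues3(3)[OF ev])
    \<comment> \<open>The order of the eigenvalues is arbitrary, so each of them can play the role of \<open>l2\<close>.\<close>
    have "l2\<^sup>2 + l1 * l3 \<noteq> 0" "l1\<^sup>2 + l2 * l3 \<noteq> 0" "l3\<^sup>2 + l1 * l2 \<noteq> 0"
      using equivalent(2)[of l1 l2 l3] equivalent(2)[of l2 l1 l3] equivalent(2)[of l1 l3 l2]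
      by (simp_all add: ev add_mset_commute)
    moreover obtain \<sigma> where \<sigma>: "rep_with_images \<sigma> (matA l1 l2 l3) (matB l1 l2 l3)"
      using exists[OF t] by blast
    moreover have "equivalent_rep B3 \<rho> \<sigma>"
      using equivalent(1)[OF ev] \<sigma> rep equivalent_rep_generatorsI unfolding rep_with_images_def by metis
    ultimately show "(l1\<^sup>2 + l2 * l3) * (l2\<^sup>2 + l1 * l3) * (l3\<^sup>2 + l1 * l2) / (l1 * l2 * l3)\<^sup>2 \<noteq> 0 \<and>
        (\<exists>\<sigma>. rep_with_images \<sigma> (matA l1 l2 l3) (matB l1 l2 l3) \<and> equivalent_rep B3 \<rho> \<sigma>)"
      using t by auto
  next
    fix l1 l2 l3 :: complex
    assume "l1 \<noteq> 0" "l2 \<noteq> 0" "l3 \<noteq> 0"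
      and "(l1\<^sup>2 + l2 * l3) * (l2\<^sup>2 + l1 * l3) * (l3\<^sup>2 + l1 * l2) / (l1 * l2 * l3)\<^sup>2 \<noteq> 0"
    then have t: "l1 * l2 * l3 \<noteq> 0"
      and "irreducible_pair (matA l1 l2 l3) (matB l1 l2 l3)"
      by (auto intro!: irreducible_pair_matA_matB)
    moreover obtain \<sigma> where \<sigma>: "rep_with_images \<sigma> (matA l1 l2 l3) (matB l1 l2 l3)"
      using exists[OF t] by blast
    moreover from \<sigma> have "representation B3 \<sigma>"
      by (simp add: rep_with_images_def)
    ultimately have "irreducible_rep B3 \<sigma>"
      unfolding irreducible_rep_iff_pair[OF \<open>representation B3 \<sigma>\<close>] by (simp add: rep_with_images_def)
    with \<sigma> show "\<exists>\<sigma>. rep_with_images \<sigma> (matA l1 l2 l3) (matB l1 l2 l3) \<and> irreducible_rep B3 \<sigma>"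
      by blast
  qed
qed

end
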